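(* Let $T$ be a $\Delta(1,2,2)$-free tournament with $n$ vertices and let $\sigma=(v_1,\dots,v_n)$ be an ordering of $T$. Suppose there is $i\in[n]$ such that every vertex of $T$ other than $v_i$ is paved in $B_\sigma(T)$ and $v_i$ is nearly paved in $B_\sigma(T)$. Then $T$ is a paving tournament.
   Context: Tournaments are finite; $X\Rightarrow Y$ means all edges between disjoint $X,Y$ go from $X$ to $Y$. $\Delta(1,2,2)$: vertices $x,y_1,y_2,z_1,z_2$ with $x\Rightarrow\{y_1,y_2\}\Rightarrow\{z_1,z_2\}\Rightarrow x$ and edges $y_1y_2,z_1z_2$; $T$ is $\Delta(1,2,2)$-free if no induced subtournament is isomorphic to it. For an ordering $\sigma=(v_1,\dots,v_n)$ of $V(T)$, the backedge graph $B_\sigma(T)$ is the undirected graph on $V(T)$ with edges $v_iv_j$ for $i>j$ with $v_iv_j\in E(T)$ (directed from $v_i$ to $v_j$). A $B_\sigma(T)$-neighbour $v_j$ of $v_i$ is a left-neighbour if $j<i$ and a right-neighbour if $j>i$. A vertex is paved in $B_\sigma(T)$ if it has at most one left-neighbour and at most one right-neighbour; it is nearly paved if it has exactly two left-neighbours and at most one right-neighbour, or at most one left-neighbour and exactly two right-neighbours. $T$ is a paving tournament if there is an ordering $\sigma=(v_1,\dots,v_n)$ such that $v_i,v_{i+1}$ are nonadjacent in $B_\sigma(T)$ for all $i\in[n-1]$ and every vertex is paved in $B_\sigma(T)$. *)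

theory Defs
  imports "Graph_Theory.Pair_Digraph" "Graph_Theory.Digraph_Isomorphism"
begin

text \<open>The locale \<^locale>\<open>pair_digraph\<close> provides finite, loop-free digraphs without parallel arcs;
  it still allows pairs of opposite arcs, which the assumption below excludes.\<close>

locale tournament = pair_digraph T for T :: "'a pair_pre_digraph" +
  assumes exactly_one_arc:
    "\<lbrakk>u \<in> pverts T; v \<in> pverts T; u \<noteq> v\<rbrakk> \<Longrightarrow> ((u, v) \<in> parcs T) \<noteq> ((v, u) \<in> parcs T)"

datatype delta122_vertex = Vx | Vy1 | Vy2 | Vz1 | Vz2

definition Delta122 :: "delta122_vertex pair_pre_digraph" where
  "Delta122 = \<lparr> pverts = {Vx, Vy1, Vy2, Vz1, Vz2},
     parcs = {Vx} \<times> {Vy1, Vy2} \<union> {Vy1, Vy2} \<times> {Vz1, Vz2} \<union> {Vz1, Vz2} \<times> {Vx}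
       \<union> {(Vy1, Vy2), (Vz1, Vz2)} \<rparr>"

definition Delta122_free :: "'a pair_pre_digraph \<Rightarrow> bool" where
  "Delta122_free T \<longleftrightarrow>
     \<not> (\<exists>H. induced_subgraph H (with_proj T) \<and> digraph_iso H (with_proj Delta122))"

text \<open>An ordering \<open>(v_1, \<dots>, v_n)\<close> is a list, so \<open>v_i\<close> is the list entry with index \<open>i - 1\<close>.\<close>

definition vertex_ordering :: "'a pair_pre_digraph \<Rightarrow> 'a list \<Rightarrow> bool" where
  "vertex_ordering T \<sigma> \<longleftrightarrow> distinct \<sigma> \<and> set \<sigma> = pverts T"

definition precedes :: "'a list \<Rightarrow> 'a \<Rightarrow> 'a \<Rightarrow> bool" where
  "precedes \<sigma> u v \<longleftrightarrow> (\<exists>i j. i < j \<and> j < length \<sigma> \<and> u = \<sigma> ! i \<and> v = \<sigma> ! j)"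

text \<open>As usual in this library, an undirected graph is a symmetric digraph: each backedge of
  \<open>T\<close> contributes both orientations.\<close>

definition backedge_graph :: "'a pair_pre_digraph \<Rightarrow> 'a list \<Rightarrow> 'a pair_pre_digraph" where
  "backedge_graph T \<sigma> = \<lparr> pverts = pverts T,
     parcs = {(u, v). (precedes \<sigma> v u \<and> (u, v) \<in> parcs T) \<or>
                      (precedes \<sigma> u v \<and> (v, u) \<in> parcs T)} \<rparr>"

definition left_neighbours :: "'a pair_pre_digraph \<Rightarrow> 'a list \<Rightarrow> 'a \<Rightarrow> 'a set" where
  "left_neighbours T \<sigma> v = {u. (v, u) \<in> parcs (backedge_graph T \<sigma>) \<and> precedes \<sigma> u v}"

definition right_neighbours :: "'a pair_pre_digraph \<Rightarrow> 'a list \<Rightarrow> 'a \<Rightarrow> 'a set" where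
  "right_neighbours T \<sigma> v = {u. (v, u) \<in> parcs (backedge_graph T \<sigma>) \<and> precedes \<sigma> v u}"

definition paved :: "'a pair_pre_digraph \<Rightarrow> 'a list \<Rightarrow> 'a \<Rightarrow> bool" where
  "paved T \<sigma> v \<longleftrightarrow> card (left_neighbours T \<sigma> v) \<le> 1 \<and> card (right_neighbours T \<sigma> v) \<le> 1"

definition nearly_paved :: "'a pair_pre_digraph \<Rightarrow> 'a list \<Rightarrow> 'a \<Rightarrow> bool" where
  "nearly_paved T \<sigma> v \<longleftrightarrow>
     (card (left_neighbours T \<sigma> v) = 2 \<and> card (right_neighbours T \<sigma> v) \<le> 1) \<or>
     (card (left_neighbours T \<sigma> v) \<le> 1 \<and> card (right_neighbours T \<sigma> v) = 2)"

definition paving_tournament :: "'a pair_pre_digraph \<Rightarrow> bool" where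
  "paving_tournament T \<longleftrightarrow> tournament T \<and>
     (\<exists>\<sigma>. vertex_ordering T \<sigma> \<and>
        (\<forall>i. Suc i < length \<sigma> \<longrightarrow> (\<sigma> ! i, \<sigma> ! Suc i) \<notin> parcs (backedge_graph T \<sigma>)) \<and>
        (\<forall>v \<in> pverts T. paved T \<sigma> v))"

lemma tournament_Delta122: "tournament Delta122"
proof unfold_locales
  have pv: "pverts Delta122 = UNIV"
    by (auto simp: Delta122_def intro: delta122_vertex.exhaust)
  show "fst e \<in> pverts Delta122" "snd e \<in> pverts Delta122" if "e \<in> parcs Delta122" for e
    by (simp_all add: pv)
  show "finite (pverts Delta122)" "finite (parcs Delta122)" by (simp_all add: Delta122_def)
  show "fst e \<noteq> snd e" if "e \<in> parcs Delta122" for e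
    using that by (auto simp: Delta122_def)
  show "((u, v) \<in> parcs Delta122) \<noteq> ((v, u) \<in> parcs Delta122)" if "u \<noteq> v" for u v
    using that by (cases u; cases v) (simp_all add: Delta122_def)
qed

lemma (in tournament) pair_graph_backedge_graph: "pair_graph (backedge_graph T \<sigma>)"
proof unfold_locales
  let ?B = "backedge_graph T \<sigma>"
  have sub: "parcs ?B \<subseteq> pverts T \<times> pverts T"
    by (auto simp: backedge_graph_def dest: in_arcsD1 in_arcsD2)
  show "fst e \<in> pverts ?B" "snd e \<in> pverts ?B" if "e \<in> parcs ?B" for e
    using that sub by (auto simp: backedge_graph_def)
  show "finite (pverts ?B)"
    by (simp add: backedge_graph_def pair_finite_verts)
  show "finite (parcs ?B)"
    using sub pair_finite_verts by (meson finite_SigmaI finite_subset)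
  show "fst e \<noteq> snd e" if "e \<in> parcs ?B" for e
    using that by (cases e) (auto simp: backedge_graph_def dest: pair_no_loops)
  show "symmetric (with_proj ?B)"
    by (auto simp: symmetric_def sym_def backedge_graph_def)
qed

end

theory Submission
  imports Defs
begin

text \<open>If every vertex is paved, exchanging two consecutive vertices joined by a backedge destroys
  that backedge and leaves the backedge graph unchanged otherwise, so an ordering with the fewest
  backedges shows that \<open>T\<close> is a paving tournament. It therefore suffices to make every vertex paved.

  The tournament \<open>\<Delta>(1,2,2)\<close> is isomorphic to its converse, so we may assume that \<open>v = v\<^sub>i\<close> has
  exactly two left-neighbours, \<open>a\<close> before \<open>b\<close>. Every vertex between \<open>b\<close> and \<open>v\<close> is dominated by
  \<open>a\<close> and \<open>b\<close> and dominates \<open>v\<close>, so there is at most one. If there is none, exchange \<open>b\<close> and \<open>v\<close>.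
  If there is exactly one, \<open>m\<close>, then \<open>v\<close> has no right-neighbour, and rotating the triangle
  \<open>b, m, v\<close> works: \<open>v, b, m\<close> if \<open>m\<close> has no left-neighbour, and \<open>m, v, b\<close> otherwise, because then
  \<open>m\<close> has no right-neighbour and \<open>b\<close> has no left-neighbour.\<close>

section \<open>Orderings\<close>

lemma precedes_Nil [simp]: "\<not> precedes [] u v"
  by (simp add: precedes_def)

lemma precedes_Cons [simp]:
  "precedes (x # xs) u v \<longleftrightarrow> (u = x \<and> v \<in> set xs) \<or> precedes xs u v"
proof
  assume "precedes (x # xs) u v"
  then obtain i j where ij: "i < j" "j < Suc (length xs)" "u = (x # xs) ! i" "v = (x # xs) ! j"
    by (auto simp: precedes_def)
  then obtain j' where [simp]: "j = Suc j'" by (cases j) auto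
  show "(u = x \<and> v \<in> set xs) \<or> precedes xs u v"
    using ij by (cases i) (auto simp: precedes_def)
next
  assume "(u = x \<and> v \<in> set xs) \<or> precedes xs u v"
  then show "precedes (x # xs) u v"
  proof
    assume "u = x \<and> v \<in> set xs"
    then obtain j where "j < length xs" "v = xs ! j" "u = x" by (auto simp: in_set_conv_nth)
    then show ?thesis unfolding precedes_def by (intro exI[of _ 0] exI[of _ "Suc j"]) simp
  next
    assume "precedes xs u v"
    then obtain i j where "i < j" "j < length xs" "u = xs ! i" "v = xs ! j"
      by (auto simp: precedes_def)
    then show ?thesis unfolding precedes_def by (intro exI[of _ "Suc i"] exI[of _ "Suc j"]) simp
  qed
qed

lemma precedes_append [simp]:
  "precedes (xs @ ys) u v \<longleftrightarrow> precedes xs u v \<or> precedes ys u v \<or> (u \<in> set xs \<and> v \<in> set ys)"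
  by (induction xs) auto

lemma precedes_rev [simp]: "precedes (rev \<sigma>) u v \<longleftrightarrow> precedes \<sigma> v u"
  by (induction \<sigma>) auto

lemma precedes_in_set: "precedes \<sigma> u v \<Longrightarrow> u \<in> set \<sigma> \<and> v \<in> set \<sigma>"
  by (auto simp: precedes_def)

lemma precedes_asym: "distinct \<sigma> \<Longrightarrow> precedes \<sigma> u v \<Longrightarrow> \<not> precedes \<sigma> v u"
  by (induction \<sigma>) (auto dest: precedes_in_set)

lemma precedes_trans: "distinct \<sigma> \<Longrightarrow> precedes \<sigma> u v \<Longrightarrow> precedes \<sigma> v w \<Longrightarrow> precedes \<sigma> u w"
  by (induction \<sigma>) (auto dest: precedes_in_set)

lemma precedes_total:
  "u \<in> set \<sigma> \<Longrightarrow> v \<in> set \<sigma> \<Longrightarrow> u \<noteq> v \<Longrightarrow> precedes \<sigma> u v \<or> precedes \<sigma> v u"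
  by (induction \<sigma>) auto

text \<open>This makes the rotation of three consecutive vertices a local change: a pair not
  contained in the block is ordered by \<open>xs\<close>, by \<open>zs\<close>, or by which parts
  contain its members, and none of these depends on the order inside the block.\<close>

lemma precedes_block_cong:
  assumes "set ys = set ys'" "u \<notin> set ys \<or> v \<notin> set ys"
  shows "precedes (xs @ ys @ zs) u v \<longleftrightarrow> precedes (xs @ ys' @ zs) u v"
proof -
  have "\<not> precedes ys u v" "\<not> precedes ys' u v"
    using assms precedes_in_set by metis+
  with assms show ?thesis by auto
qed

text \<open>Adjacency in \<open>backedge_graph\<close> is a disjunction of two orientations.
  Distinctness makes \<open>precedes\<close> asymmetric, so only one disjunct survives.\<close>

lemma left_neighbours_iff:
  "distinct \<sigma> \<Longrightarrow> u \<in> left_neighbours T \<sigma> v \<longleftrightarrow> precedes \<sigma> u v \<and> (v, u) \<in> parcs T"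
  by (auto simp: left_neighbours_def backedge_graph_def dest: precedes_asym)

lemma right_neighbours_iff:
  "distinct \<sigma> \<Longrightarrow> u \<in> right_neighbours T \<sigma> v \<longleftrightarrow> precedes \<sigma> v u \<and> (u, v) \<in> parcs T"
  by (auto simp: right_neighbours_def backedge_graph_def dest: precedes_asym)

lemma neighbours_outside_block:
  assumes "distinct (xs @ ys @ zs)" "distinct (xs @ ys' @ zs)" "set ys = set ys'" "w \<notin> set ys"
  shows "left_neighbours T (xs @ ys' @ zs) w = left_neighbours T (xs @ ys @ zs) w"
    and "right_neighbours T (xs @ ys' @ zs) w = right_neighbours T (xs @ ys @ zs) w"
proof -
  have "precedes (xs @ ys' @ zs) u w \<longleftrightarrow> precedes (xs @ ys @ zs) u w"
    "precedes (xs @ ys' @ zs) w u \<longleftrightarrow> precedes (xs @ ys @ zs) w u" for u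
    using assms precedes_block_cong[of ys ys'] by metis+
  then show "left_neighbours T (xs @ ys' @ zs) w = left_neighbours T (xs @ ys @ zs) w"
    "right_neighbours T (xs @ ys' @ zs) w = right_neighbours T (xs @ ys @ zs) w"
    by (simp_all only: set_eq_iff left_neighbours_iff[OF assms(1)] left_neighbours_iff[OF assms(2)]
        right_neighbours_iff[OF assms(1)] right_neighbours_iff[OF assms(2)]) simp_all
qed

lemma paved_outside_block:
  assumes "distinct (xs @ ys @ zs)" "distinct (xs @ ys' @ zs)" "set ys = set ys'" "w \<notin> set ys"
  shows "paved T (xs @ ys' @ zs) w \<longleftrightarrow> paved T (xs @ ys @ zs) w"
  using neighbours_outside_block[OF assms] by (simp add: paved_def)

text \<open>Each backedge is recorded once, as an arc of \<open>T\<close>, so the cardinality counts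
  the edges of the backedge graph. It is the measure for the descent by exchanges.\<close>

definition backedges :: "'a pair_pre_digraph \<Rightarrow> 'a list \<Rightarrow> ('a \<times> 'a) set" where
  "backedges T \<sigma> = {(u, v) \<in> parcs T. precedes \<sigma> v u}"

section \<open>Tournaments without the pattern of \<open>\<Delta>(1,2,2)\<close>\<close>

text \<open>The arcs inside the two pairs are left open: in a tournament they can be oriented as required
  by naming the vertices of each pair appropriately. This makes the condition invariant under
  taking converses.\<close>

definition pattern_free :: "'a pair_pre_digraph \<Rightarrow> bool" where
  "pattern_free T \<longleftrightarrow> (\<forall>x y y' z z'. y \<noteq> y' \<longrightarrow> z \<noteq> z' \<longrightarrow>
     {x} \<times> {y, y'} \<union> {y, y'} \<times> {z, z'} \<union> {z, z'} \<times> {x} \<subseteq> parcs T \<longrightarrow> False)"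

lemma pattern_freeD:
  assumes "pattern_free T" "y \<noteq> y'" "z \<noteq> z'"
    "(x, y) \<in> parcs T" "(x, y') \<in> parcs T" "(y, z) \<in> parcs T" "(y, z') \<in> parcs T"
    "(y', z) \<in> parcs T" "(y', z') \<in> parcs T" "(z, x) \<in> parcs T" "(z', x) \<in> parcs T"
  shows False
  using assms unfolding pattern_free_def by simp

context tournament
begin

lemma arc_asym: "(u, v) \<in> parcs T \<Longrightarrow> (v, u) \<notin> parcs T"
  by (metis exactly_one_arc fst_conv in_arcsD1 in_arcsD2 pair_no_loops snd_conv)

lemma no_loop: "(u, u) \<notin> parcs T"
  using arc_asym by blast

lemma induces_Delta122:
  assumes "y \<noteq> y'" "z \<noteq> z'"
    and arcs: "(x, y) \<in> parcs T" "(x, y') \<in> parcs T" "(y, z) \<in> parcs T" "(y, z') \<in> parcs T"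
      "(y', z) \<in> parcs T" "(y', z') \<in> parcs T" "(z, x) \<in> parcs T" "(z', x) \<in> parcs T"
      "(y, y') \<in> parcs T" "(z, z') \<in> parcs T"
  shows "\<not> Delta122_free T"
proof -
  let ?S = "{x, y, y', z, z'}"
  \<comment> \<open>Vertices of different classes are joined by an arc, and there are no
    loops.\<close>
  have ne: "x \<noteq> y" "x \<noteq> y'" "x \<noteq> z" "x \<noteq> z'" "y \<noteq> z" "y \<noteq> z'" "y' \<noteq> z" "y' \<noteq> z'"
    using arcs no_loop by auto
  note distinct_vertices = assms(1,2) ne assms(1,2)[symmetric] ne[symmetric]
  define H where "H = with_proj T \<restriction> ?S"
  define g where "g w = (if w = x then Vx else if w = y then Vy1 else if w = y' then Vy2
    else if w = z then Vz1 else Vz2)" for w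
  \<comment> \<open>Arcs of \<open>H\<close> are pairs of vertices, so the arc map is induced by the
    vertex map \<open>g\<close>.\<close>
  define f :: "('a, 'a \<times> 'a, delta122_vertex, delta122_vertex \<times> delta122_vertex) digraph_isomorphism"
    where "f = \<lparr> iso_verts = g, iso_arcs = map_prod g g, iso_head = snd, iso_tail = fst \<rparr>"
  have S: "?S \<subseteq> pverts T"
    using arcs in_arcsD1 by auto
  \<comment> \<open>The ten given arcs cover all pairs of the five vertices, and
    \<open>arc_asym\<close> excludes their reverses.\<close>
  have arcs_H: "arcs H = {x} \<times> {y, y'} \<union> {y, y'} \<times> {z, z'} \<union> {z, z'} \<times> {x} \<union> {(y, y'), (z, z')}"
    (is "_ = ?A")
  proof -
    have "(u, w) \<in> arcs H \<longleftrightarrow> (u, w) \<in> ?A" for u w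
    proof (cases "u \<in> ?S \<and> w \<in> ?S")
      case True
      then have "u = x \<or> u = y \<or> u = y' \<or> u = z \<or> u = z'" "w = x \<or> w = y \<or> w = y' \<or> w = z \<or> w = z'"
        by simp_all
      then show ?thesis
        by (elim disjE) (simp_all add: H_def arcs arcs[THEN arc_asym] no_loop distinct_vertices)
    next
      case False
      then show ?thesis
        by (auto simp: H_def)
    qed
    then show ?thesis
      by (intro set_eqI) (simp only: split_paired_all)
  qed
  have verts_H: "verts H = ?S" "tail H = fst" "head H = snd"
    by (auto simp: H_def)
  have wf: "wf_digraph H"
    unfolding H_def by (rule wellformed_induce_subgraph)
  have inj: "inj_on g ?S"
    using distinct_vertices by (auto simp: inj_on_def g_def)
  have "induced_subgraph H (with_proj T)"
    unfolding H_def using S by (intro induced_induce) simp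
  moreover have "digraph_iso H (with_proj Delta122)"
  proof -
    have "inj_on (map_prod g g) (arcs H)"
      by (rule inj_on_subset[OF map_prod_inj_on[OF inj inj]]) (auto simp: arcs_H)
    then have "pre_digraph.digraph_isomorphism H f"
      unfolding pre_digraph.digraph_isomorphism_def using wf inj by (simp add: f_def verts_H)
    moreover have "with_proj Delta122 = app_iso f H"
      using distinct_vertices
      by (intro pre_digraph.equality) (auto simp: f_def verts_H arcs_H Delta122_def g_def)
    ultimately show ?thesis
      unfolding digraph_iso_def by blast
  qed
  ultimately show ?thesis
    unfolding Delta122_free_def by blast
qed

lemma Delta122_free_imp_pattern_free:
  assumes "Delta122_free T"
  shows "pattern_free T"
  unfolding pattern_free_def
proof (intro allI impI)
  fix x y y' z z'
  assume ne: "y \<noteq> y'" "z \<noteq> z'"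
    and "{x} \<times> {y, y'} \<union> {y, y'} \<times> {z, z'} \<union> {z, z'} \<times> {x} \<subseteq> parcs T"
  then have arcs: "(x, y) \<in> parcs T" "(x, y') \<in> parcs T" "(y, z) \<in> parcs T" "(y, z') \<in> parcs T"
      "(y', z) \<in> parcs T" "(y', z') \<in> parcs T" "(z, x) \<in> parcs T" "(z', x) \<in> parcs T"
    by auto
  have "(y, y') \<in> parcs T \<or> (y', y) \<in> parcs T" "(z, z') \<in> parcs T \<or> (z', z) \<in> parcs T"
    using ne arcs exactly_one_arc in_arcsD1 by metis+
  then show False
    using induces_Delta122 ne arcs assms by metis
qed

section \<open>Orderings in which every vertex is paved\<close>

lemma left_neighbours_subset: "left_neighbours T \<sigma> v \<subseteq> pverts T"
  by (auto simp: left_neighbours_def backedge_graph_def dest: in_arcsD1 in_arcsD2)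

lemma right_neighbours_subset: "right_neighbours T \<sigma> v \<subseteq> pverts T"
  by (auto simp: right_neighbours_def backedge_graph_def dest: in_arcsD1 in_arcsD2)

text \<open>Since \<open>card\<close> is 0 on infinite sets, the bounds in \<open>paved\<close>
  limit the neighbours only together with finiteness.\<close>

lemma finite_neighbours [simp]: "finite (left_neighbours T \<sigma> v)" "finite (right_neighbours T \<sigma> v)"
  by (rule finite_subset[OF left_neighbours_subset pair_finite_verts]
      finite_subset[OF right_neighbours_subset pair_finite_verts])+

lemma paved_mono:
  assumes "paved T \<sigma> v" "left_neighbours T \<tau> v \<subseteq> left_neighbours T \<sigma> v"
    "right_neighbours T \<tau> v \<subseteq> right_neighbours T \<sigma> v"
  shows "paved T \<tau> v"
  using assms(1) card_mono[OF _ assms(2)] card_mono[OF _ assms(3)] by (simp add: paved_def)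

lemma pavedI:
  assumes "left_neighbours T \<sigma> v \<subseteq> {p}" "right_neighbours T \<sigma> v \<subseteq> {q}"
  shows "paved T \<sigma> v"
  using card_mono[OF _ assms(1)] card_mono[OF _ assms(2)] by (simp add: paved_def)

lemma paved_left_unique:
  "paved T \<sigma> v \<Longrightarrow> p \<in> left_neighbours T \<sigma> v \<Longrightarrow> q \<in> left_neighbours T \<sigma> v \<Longrightarrow> p = q"
  by (simp add: paved_def card_le_Suc0_iff_eq)

lemma paved_right_unique:
  "paved T \<sigma> v \<Longrightarrow> p \<in> right_neighbours T \<sigma> v \<Longrightarrow> q \<in> right_neighbours T \<sigma> v \<Longrightarrow> p = q"
  by (simp add: paved_def card_le_Suc0_iff_eq)

text \<open>Only the pair \<open>x\<close>, \<open>y\<close> changes its order, and its arc now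
  points forward. The explicit removal of \<open>x\<close> on the left of \<open>y\<close> is what
  later brings two left-neighbours down to one.\<close>

lemma swap_backedge:
  assumes d: "distinct (xs @ [x, y] @ zs)" and yx: "(y, x) \<in> parcs T"
  shows "left_neighbours T (xs @ [y, x] @ zs) w \<subseteq> left_neighbours T (xs @ [x, y] @ zs) w - (if w = y then {x} else {})"
    and "right_neighbours T (xs @ [y, x] @ zs) w \<subseteq> right_neighbours T (xs @ [x, y] @ zs) w"
    and "backedges T (xs @ [y, x] @ zs) \<subset> backedges T (xs @ [x, y] @ zs)"
proof -
  have xy: "(x, y) \<notin> parcs T" using yx by (rule arc_asym)
  show "left_neighbours T (xs @ [y, x] @ zs) w \<subseteq> left_neighbours T (xs @ [x, y] @ zs) w - (if w = y then {x} else {})"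
    using d xy
    by (auto simp: left_neighbours_iff dest: precedes_in_set)
  show "right_neighbours T (xs @ [y, x] @ zs) w \<subseteq> right_neighbours T (xs @ [x, y] @ zs) w"
    using d xy by (auto simp: right_neighbours_iff)
  have "backedges T (xs @ [y, x] @ zs) \<subseteq> backedges T (xs @ [x, y] @ zs)"
    using xy by (auto simp: backedges_def)
  moreover have "(y, x) \<in> backedges T (xs @ [x, y] @ zs)"
    using yx by (auto simp: backedges_def)
  moreover have "(y, x) \<notin> backedges T (xs @ [y, x] @ zs)"
    using d by (auto simp: backedges_def dest: precedes_in_set)
  ultimately show "backedges T (xs @ [y, x] @ zs) \<subset> backedges T (xs @ [x, y] @ zs)"
    by blast
qed

lemma paving_tournament_if_all_paved:
  assumes "vertex_ordering T \<sigma>" "\<forall>v \<in> pverts T. paved T \<sigma> v"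
  shows "paving_tournament T"
  using assms
proof (induction "card (backedges T \<sigma>)" arbitrary: \<sigma> rule: less_induct)
  case less
  note d = less.prems(1)[unfolded vertex_ordering_def]
  show ?case
  proof (cases "\<forall>i. Suc i < length \<sigma> \<longrightarrow> (\<sigma> ! i, \<sigma> ! Suc i) \<notin> parcs (backedge_graph T \<sigma>)")
    case True
    with less.prems tournament_axioms show ?thesis
      unfolding paving_tournament_def by blast
  next
    case False
    then obtain i where i: "Suc i < length \<sigma>"
      and edge: "(\<sigma> ! i, \<sigma> ! Suc i) \<in> parcs (backedge_graph T \<sigma>)"
      by blast
    define x y xs zs where "x = \<sigma> ! i" "y = \<sigma> ! Suc i" "xs = take i \<sigma>" "zs = drop (Suc (Suc i)) \<sigma>"
    have \<sigma>: "\<sigma> = xs @ [x, y] @ zs"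
      using i by (simp add: x_y_xs_zs_def id_take_nth_drop[symmetric] Cons_nth_drop_Suc)
    have "precedes \<sigma> x y"
      by (simp add: \<sigma>)
    then have yx: "(y, x) \<in> parcs T"
      using edge d by (auto simp: backedge_graph_def x_y_xs_zs_def dest: precedes_asym)
    let ?\<tau> = "xs @ [y, x] @ zs"
    have dist: "distinct (xs @ [x, y] @ zs)" using d \<sigma> by simp
    note swap = swap_backedge[OF dist yx]
    have "finite (backedges T \<sigma>)"
      by (rule finite_subset[OF _ pair_finite_arcs]) (auto simp: backedges_def)
    then have "card (backedges T ?\<tau>) < card (backedges T \<sigma>)"
      using swap(3) by (auto simp only: \<sigma> intro: psubset_card_mono)
    moreover have "vertex_ordering T ?\<tau>"
      using d unfolding vertex_ordering_def \<sigma> by auto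
    moreover have "\<forall>v \<in> pverts T. paved T ?\<tau> v"
      using less.prems(2) swap(1,2) unfolding \<sigma> by (blast intro: paved_mono)
    ultimately show ?thesis by (rule less.hyps)
  qed
qed

section \<open>Two left-neighbours\<close>

text \<open>Assuming \<open>pattern_free\<close> instead of \<open>Delta122_free\<close> lets the
  lemma be applied to the converse tournament as well.\<close>

lemma nearly_paved_left_all_paved:
  assumes free: "pattern_free T" and ord: "vertex_ordering T \<sigma>"
    and others: "\<forall>w \<in> pverts T. w \<noteq> v \<longrightarrow> paved T \<sigma> w"
    and two: "card (left_neighbours T \<sigma> v) = 2" and one: "card (right_neighbours T \<sigma> v) \<le> 1"
  shows "\<exists>\<tau>. vertex_ordering T \<tau> \<and> (\<forall>w \<in> pverts T. paved T \<tau> w)"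
proof -
  have dist: "distinct \<sigma>" and set_\<sigma>: "set \<sigma> = pverts T"
    using ord by (auto simp: vertex_ordering_def)
  note left_iff = left_neighbours_iff[OF dist] and right_iff = right_neighbours_iff[OF dist]
  have back_or_forth: "(u, w) \<in> parcs T \<or> (w, u) \<in> parcs T" if "precedes \<sigma> u w" for u w
    using that exactly_one_arc precedes_in_set precedes_asym[OF dist] set_\<sigma> by metis
  \<comment> \<open>This and the next fact are mostly used in contraposition: once one neighbour of
    \<open>w\<close> on a side is known, the arcs between \<open>w\<close> and all other vertices on
    that side point forward.\<close>
  have right_of_unique: "p = q"
    if "w \<noteq> v" "(p, w) \<in> parcs T" "(q, w) \<in> parcs T" "precedes \<sigma> w p" "precedes \<sigma> w q" for p q w
    using that others paved_right_unique right_iff in_arcsD2 by metis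
  have left_of_unique: "p = q"
    if "w \<noteq> v" "(w, p) \<in> parcs T" "(w, q) \<in> parcs T" "precedes \<sigma> p w" "precedes \<sigma> q w" for p q w
    using that others paved_left_unique left_iff in_arcsD1 by metis
  obtain a b where left_v: "left_neighbours T \<sigma> v = {a, b}" and ab: "precedes \<sigma> a b"
  proof -
    obtain p q where pq: "left_neighbours T \<sigma> v = {p, q}" "p \<noteq> q"
      using two by (meson card_2_iff)
    then have "p \<in> set \<sigma>" "q \<in> set \<sigma>"
      using set_\<sigma> left_neighbours_subset by blast+
    then show ?thesis
      using that pq precedes_total[of p \<sigma> q] by (metis insert_commute)
  qed
  have va: "(v, a) \<in> parcs T" "precedes \<sigma> a v" and vb: "(v, b) \<in> parcs T" "precedes \<sigma> b v"
    using left_v left_iff by blast+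
  have left_of_v: "p = a \<or> p = b" if "(v, p) \<in> parcs T" "precedes \<sigma> p v" for p
    using that left_v left_iff by blast
  have ne: "a \<noteq> b" "a \<noteq> v" "b \<noteq> v"
    using ab va vb no_loop precedes_asym[OF dist] by blast+
  have "v \<in> set \<sigma>" "a \<in> set \<sigma>" "b \<in> set \<sigma>"
    using va vb precedes_in_set by metis+
  then obtain xs ms zs where \<sigma>: "\<sigma> = xs @ b # ms @ v # zs"
  proof -
    obtain xs ys where 1: "\<sigma> = xs @ b # ys"
      using \<open>b \<in> set \<sigma>\<close> by (meson split_list)
    then have "v \<in> set ys"
      using vb dist by (auto dest: precedes_in_set)
    then show ?thesis
      using that 1 by (metis split_list)
  qed
  \<comment> \<open>\<open>v\<close> is already the right-neighbour of \<open>a\<close> and of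
    \<open>b\<close>, and it has no left-neighbours besides these two. Hence all arcs from
    \<open>a\<close> and \<open>b\<close> to \<open>p\<close> and from \<open>p\<close> to
    \<open>v\<close> point forward.\<close>
  have between: "(a, p) \<in> parcs T \<and> (b, p) \<in> parcs T \<and> (p, v) \<in> parcs T" if "p \<in> set ms" for p
  proof -
    have bp: "precedes \<sigma> b p" and pv: "precedes \<sigma> p v"
      using that by (auto simp: \<sigma>)
    have ap: "precedes \<sigma> a p"
      using ab bp precedes_trans[OF dist] by blast
    have "p \<noteq> v" "p \<noteq> b" "p \<noteq> a"
      using ap bp pv precedes_asym[OF dist] by blast+
    then show ?thesis
      using ap bp pv ne va vb back_or_forth right_of_unique left_of_v by metis
  qed
  consider (none) "ms = []" | (one) m where "ms = [m]"
    | (many) m m' where "m \<in> set ms" "m' \<in> set ms" "m \<noteq> m'"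
  \<comment> \<open>The rule serves only to split lists into empty, singleton and longer
    ones.\<close>
  proof (cases ms rule: remdups_adj.cases)
    case (3 m m' ms')
    then show ?thesis using that(3)[of m m'] dist \<sigma> by auto
  qed (use that in auto)
  then show ?thesis
  proof cases
    case none
    then have s: "\<sigma> = xs @ [b, v] @ zs" using \<sigma> by simp
    let ?\<tau> = "xs @ [v, b] @ zs"
    have d: "distinct (xs @ [b, v] @ zs)" using dist s by simp
    note swap = swap_backedge[OF d vb(1)]
    have "paved T ?\<tau> w" if "w \<in> pverts T" for w
    proof (cases "w = v")
      case True
      have "left_neighbours T ?\<tau> v \<subseteq> {a}"
        using swap(1)[of v] left_v unfolding s by auto
      then have "card (left_neighbours T ?\<tau> v) \<le> 1"
        using card_mono[of "{a}"] by simp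
      moreover have "card (right_neighbours T ?\<tau> v) \<le> 1"
        using card_mono[OF finite_neighbours(2) swap(2)[of v]] one unfolding s by linarith
      ultimately show ?thesis
        using True by (simp add: paved_def)
    next
      case False
      then have "paved T (xs @ [b, v] @ zs) w"
        using others that s by blast
      then show ?thesis
        using swap(1,2)[of w] by (blast intro: paved_mono)
    qed
    moreover have "vertex_ordering T ?\<tau>"
      using ord unfolding s vertex_ordering_def by auto
    ultimately show ?thesis by blast
  next
    case many
    \<comment> \<open>The pattern is v => {a, b} => {m, m'} => v.\<close>
    then show ?thesis
      using pattern_freeD[OF free ne(1) many(3) va(1) vb(1)] between by blast
  next
    case (one m)
    have s: "\<sigma> = xs @ [b, m, v] @ zs" using \<sigma> one by simp
    have am: "(a, m) \<in> parcs T" and bm: "(b, m) \<in> parcs T" and mv: "(m, v) \<in> parcs T"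
      using between one by auto
    have order: "precedes \<sigma> b m" "precedes \<sigma> m v" "precedes \<sigma> a m"
      using ab precedes_trans[OF dist] by (auto simp: s)
    have ne': "a \<noteq> m" "b \<noteq> m" "m \<noteq> v"
      using am bm mv no_loop by blast+
    have arc: "(u, w) \<in> parcs T" if "precedes \<sigma> u w" "(w, u) \<notin> parcs T" for u w
      using that back_or_forth by blast
    \<comment> \<open>The only left-neighbour of such a \<open>c\<close> would be \<open>v\<close>,
      so \<open>a\<close> and \<open>b\<close> dominate \<open>c\<close>, giving v => {a, b} => {m,
      c} => v.\<close>
    have right_v: "right_neighbours T \<sigma> v = {}"
    proof (rule ccontr)
      assume "right_neighbours T \<sigma> v \<noteq> {}"
      then obtain c where c: "precedes \<sigma> v c" "(c, v) \<in> parcs T"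
        using right_iff by blast
      have "precedes \<sigma> a c" "precedes \<sigma> b c"
        using c va vb precedes_trans[OF dist] by blast+
      moreover have "c \<noteq> v" "m \<noteq> c"
        using c order precedes_asym[OF dist] by blast+
      ultimately have "(a, c) \<in> parcs T" "(b, c) \<in> parcs T"
        using arc left_of_unique[of c v] c ne by blast+
      then show False
        using pattern_freeD[OF free ne(1) \<open>m \<noteq> c\<close> va(1) vb(1)] am bm mv c(2) by blast
    qed
    have right_b: "right_neighbours T \<sigma> b \<subseteq> {v}"
      using right_of_unique[of b _ v] vb ne right_iff by blast
    have paved_block: "paved T \<tau> w" if "\<tau> = xs @ ys @ zs" "distinct \<tau>" "set ys = {b, m, v}"
      "w \<in> pverts T" "paved T \<tau> b" "paved T \<tau> m" "paved T \<tau> v" for \<tau> ys w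
    proof (cases "w \<in> {b, m, v}")
      case False
      then have "paved T (xs @ ys @ zs) w \<longleftrightarrow> paved T (xs @ [b, m, v] @ zs) w"
        using that dist s by (intro paved_outside_block) auto
      then show ?thesis
        using that(1,4) others False s by auto
    qed (use that in auto)
    show ?thesis
    proof (cases "left_neighbours T \<sigma> m = {}")
      case True
      \<comment> \<open>Here \<open>v\<close>-\<open>b\<close> is no longer a backedge, and the only
        new one is \<open>m\<close>-\<open>v\<close>. There is room for it, since \<open>m\<close>
        had no left-neighbour and \<open>v\<close> no right-neighbour.\<close>
      let ?\<tau> = "xs @ [v, b, m] @ zs"
      have d: "distinct ?\<tau>" using dist s by auto
      have "left_neighbours T ?\<tau> v \<subseteq> left_neighbours T \<sigma> v - {b}"
        "right_neighbours T ?\<tau> v \<subseteq> insert m (right_neighbours T \<sigma> v)"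
        "left_neighbours T ?\<tau> b \<subseteq> left_neighbours T \<sigma> b"
        "right_neighbours T ?\<tau> b \<subseteq> right_neighbours T \<sigma> b"
        "left_neighbours T ?\<tau> m \<subseteq> insert v (left_neighbours T \<sigma> m)"
        "right_neighbours T ?\<tau> m \<subseteq> right_neighbours T \<sigma> m"
        using d arc_asym[OF vb(1)] arc_asym[OF mv] arc_asym[OF bm]
        by (auto simp: left_neighbours_iff right_neighbours_iff s dest: precedes_in_set)
      then have v: "left_neighbours T ?\<tau> v \<subseteq> {a}" "right_neighbours T ?\<tau> v \<subseteq> {m}"
        and b: "paved T ?\<tau> b"
        and m: "left_neighbours T ?\<tau> m \<subseteq> {v}"
          "right_neighbours T ?\<tau> m \<subseteq> right_neighbours T \<sigma> m"
        using left_v right_v True paved_mono[of \<sigma> b ?\<tau>] others ne(3) in_arcsD2[OF vb(1)]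
        by simp_all blast
      have "paved T \<sigma> m"
        using others ne'(3) in_arcsD1[OF mv] by blast
      then have "card (right_neighbours T ?\<tau> m) \<le> 1"
        using card_mono[OF finite_neighbours(2) m(2)] by (simp add: paved_def)
      then have m': "paved T ?\<tau> m"
        using card_mono[OF _ m(1)] by (simp add: paved_def)
      have v': "paved T ?\<tau> v" using v by (rule pavedI)
      have "paved T ?\<tau> w" if "w \<in> pverts T" for w
        by (rule paved_block[OF refl d _ that b m' v']) auto
      moreover have "vertex_ordering T ?\<tau>"
        using ord unfolding s vertex_ordering_def by auto
      ultimately show ?thesis by blast
    next
      case False
      then obtain p where p: "precedes \<sigma> p m" "(m, p) \<in> parcs T"
        using left_iff by blast
      have pv: "precedes \<sigma> p v"
        using p order precedes_trans[OF dist] by blast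
      have "p \<noteq> b" "p \<noteq> a" "p \<noteq> v" "p \<noteq> m"
        using p pv am bm arc_asym precedes_asym[OF dist] by blast+
      \<comment> \<open>\<open>m\<close> is the only right-neighbour of \<open>p\<close>.\<close>
      have p_right: "(p, w) \<in> parcs T" if "precedes \<sigma> p w" "w \<noteq> m" for w
        using that p right_of_unique[of p m w] \<open>p \<noteq> v\<close> arc by blast
      \<comment> \<open>\<open>b\<close> is the immediate predecessor of \<open>m\<close>.\<close>
      have "precedes \<sigma> p b"
        using p(1) dist \<open>p \<noteq> b\<close> no_loop p(2) by (auto simp: s dest: precedes_in_set)
      then have pb: "(p, b) \<in> parcs T"
        using p_right ne' by blast
      \<comment> \<open>Otherwise \<open>p\<close> dominates \<open>a\<close>, and m => {p, v} =>
        {a, b} => m.\<close>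
      have ap: "precedes \<sigma> a p"
      proof (rule ccontr)
        assume "\<not> precedes \<sigma> a p"
        then have "(p, a) \<in> parcs T"
          using p_right ne' \<open>p \<noteq> a\<close> precedes_total[of a \<sigma> p] precedes_in_set va(2) pv by metis
        then show False
          using pattern_freeD[OF free \<open>p \<noteq> v\<close> ne(1) p(2) mv _ pb va(1) vb(1) am bm] by blast
      qed
      \<comment> \<open>Such an \<open>r\<close> lies after \<open>v\<close> and has
        \<open>m\<close> as its only left-neighbour, so m => {p, v} => {b, r} => m.\<close>
      have right_m: "right_neighbours T \<sigma> m = {}"
      proof (rule ccontr)
        assume "right_neighbours T \<sigma> m \<noteq> {}"
        then obtain r where r: "precedes \<sigma> m r" "(r, m) \<in> parcs T"
          using right_iff by blast
        have "r \<noteq> v" "r \<noteq> b" "r \<noteq> m"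
          using r mv bm arc_asym no_loop order(1) precedes_asym[OF dist] by blast+
        have "precedes \<sigma> v r"
          using r(1) dist \<open>r \<noteq> v\<close> by (auto simp: s dest: precedes_in_set)
        moreover have "precedes \<sigma> p r"
          using p(1) r(1) precedes_trans[OF dist] by blast
        ultimately have "(v, r) \<in> parcs T" "(p, r) \<in> parcs T"
          using arc p_right \<open>r \<noteq> m\<close> left_of_unique[of r m v] \<open>r \<noteq> v\<close> r ne'(3) by blast+
        then show False
          using pattern_freeD[OF free \<open>p \<noteq> v\<close> \<open>r \<noteq> b\<close>[symmetric] p(2) mv pb _ vb(1) _ bm r(2)]
          by blast
      qed
      \<comment> \<open>The only right-neighbour of such an \<open>l\<close> is \<open>b\<close>, so
        \<open>l\<close> dominates every other later vertex. If \<open>a\<close> came before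
        \<open>l\<close>, then v => {a, b} => {m, l} => v. So \<open>l\<close> precedes
        \<open>a\<close>, hence also \<open>p\<close>, and b => {l, m} => {v, p} => b.\<close>
      have left_b: "left_neighbours T \<sigma> b = {}"
      proof (rule ccontr)
        assume "left_neighbours T \<sigma> b \<noteq> {}"
        then obtain l where l: "precedes \<sigma> l b" "(b, l) \<in> parcs T"
          using left_iff by blast
        have "l \<noteq> v" "l \<noteq> m" "l \<noteq> p" "l \<noteq> a"
          using l vb pb order(1) arc_asym precedes_asym[OF dist] right_of_unique[of a b v] va ne
          by blast+
        have l_right: "(l, w) \<in> parcs T" if "precedes \<sigma> l w" "w \<noteq> b" for w
          using that l right_of_unique[of l b w] \<open>l \<noteq> v\<close> arc by blast
        have lv: "(l, v) \<in> parcs T"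
          using l_right l(1) vb(2) ne(3) precedes_trans[OF dist] by blast
        have "precedes \<sigma> l a"
        proof (rule ccontr)
          assume "\<not> precedes \<sigma> l a"
          then have "precedes \<sigma> a l"
            using precedes_total[of a \<sigma> l] precedes_in_set va(2) l(1) \<open>l \<noteq> a\<close> by metis
          then have "(a, l) \<in> parcs T"
            using arc right_of_unique[of a l v] va ne(2) \<open>l \<noteq> v\<close> by blast
          then show False
            using pattern_freeD[OF free ne(1) \<open>l \<noteq> m\<close>[symmetric] va(1) vb(1) am _ bm l(2) mv lv]
            by blast
        qed
        then have "(l, p) \<in> parcs T"
          using l_right ap precedes_trans[OF dist] \<open>p \<noteq> b\<close> by blast
        then show False
          using pattern_freeD[OF free \<open>l \<noteq> m\<close> \<open>p \<noteq> v\<close>[symmetric] l(2) bm lv _ mv p(2) vb(1) pb]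
          by blast
      qed
      have left_m: "left_neighbours T \<sigma> m \<subseteq> {p}"
        using left_of_unique[of m _ p] p ne'(3) left_iff by blast
      \<comment> \<open>Again \<open>v\<close>-\<open>b\<close> is no longer a backedge; the new one
        is \<open>m\<close>-\<open>b\<close>, for which \<open>right_m\<close> and
        \<open>left_b\<close> leave room.\<close>
      let ?\<tau> = "xs @ [m, v, b] @ zs"
      have d: "distinct ?\<tau>" using dist s by auto
      have "left_neighbours T ?\<tau> v \<subseteq> left_neighbours T \<sigma> v - {b}"
        "right_neighbours T ?\<tau> v \<subseteq> right_neighbours T \<sigma> v"
        "left_neighbours T ?\<tau> b \<subseteq> insert m (left_neighbours T \<sigma> b)"
        "right_neighbours T ?\<tau> b \<subseteq> right_neighbours T \<sigma> b - {v}"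
        "left_neighbours T ?\<tau> m \<subseteq> left_neighbours T \<sigma> m"
        "right_neighbours T ?\<tau> m \<subseteq> insert b (right_neighbours T \<sigma> m)"
        using d arc_asym[OF vb(1)] arc_asym[OF mv] arc_asym[OF bm]
        by (auto simp: left_neighbours_iff right_neighbours_iff s dest: precedes_in_set)
      \<comment> \<open>The right-neighbourhoods of \<open>v\<close> and \<open>b\<close> are in
        fact empty; their bounds are arbitrary singletons, the form that \<open>pavedI\<close>
        takes.\<close>
      then have "left_neighbours T ?\<tau> v \<subseteq> {a}" "right_neighbours T ?\<tau> v \<subseteq> {a}"
        "left_neighbours T ?\<tau> b \<subseteq> {m}" "right_neighbours T ?\<tau> b \<subseteq> {m}"
        "left_neighbours T ?\<tau> m \<subseteq> {p}" "right_neighbours T ?\<tau> m \<subseteq> {b}"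
        using left_v right_v left_b right_b right_m left_m by blast+
      then have block: "paved T ?\<tau> b" "paved T ?\<tau> m" "paved T ?\<tau> v"
        by (blast intro: pavedI)+
      have "paved T ?\<tau> w" if "w \<in> pverts T" for w
        by (rule paved_block[OF refl d _ that block]) auto
      moreover have "vertex_ordering T ?\<tau>"
        using ord unfolding s vertex_ordering_def by auto
      ultimately show ?thesis by blast
    qed
  qed
qed

end

section \<open>Two right-neighbours\<close>

definition converse_digraph :: "'a pair_pre_digraph \<Rightarrow> 'a pair_pre_digraph" where
  "converse_digraph T = \<lparr> pverts = pverts T, parcs = (parcs T)\<inverse> \<rparr>"

lemma converse_digraph_simps [simp]:
  "pverts (converse_digraph T) = pverts T"
  "parcs (converse_digraph T) = (parcs T)\<inverse>"
  by (simp_all add: converse_digraph_def)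

lemma vertex_ordering_converse [simp]:
  "vertex_ordering (converse_digraph T) (rev \<sigma>) \<longleftrightarrow> vertex_ordering T \<sigma>"
  by (simp add: vertex_ordering_def)

text \<open>An arc that points backwards still does so when all arcs and the ordering are both
  reversed; only the sides are exchanged.\<close>

lemma neighbours_converse [simp]:
  "left_neighbours (converse_digraph T) (rev \<sigma>) v = right_neighbours T \<sigma> v"
  "right_neighbours (converse_digraph T) (rev \<sigma>) v = left_neighbours T \<sigma> v"
  by (auto simp: left_neighbours_def right_neighbours_def backedge_graph_def)

lemma paved_converse [simp]: "paved (converse_digraph T) (rev \<sigma>) v \<longleftrightarrow> paved T \<sigma> v"
  by (auto simp: paved_def)

text \<open>Reversing x => {y, y'} => {z, z'} => x gives x => {z, z'} => {y, y'} => x, the same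
  pattern with the pairs exchanged.\<close>

lemma pattern_free_converse:
  assumes "pattern_free T"
  shows "pattern_free (converse_digraph T)"
  unfolding pattern_free_def
proof (intro allI impI)
  fix x y y' z z'
  assume "y \<noteq> y'" "z \<noteq> z'"
    "{x} \<times> {y, y'} \<union> {y, y'} \<times> {z, z'} \<union> {z, z'} \<times> {x} \<subseteq> parcs (converse_digraph T)"
  then show False
    using pattern_freeD[OF assms, of z z' y y' x] by simp
qed

lemma (in tournament) tournament_converse: "tournament (converse_digraph T)"
proof unfold_locales
  show "fst e \<in> pverts (converse_digraph T)" "snd e \<in> pverts (converse_digraph T)"
    if "e \<in> parcs (converse_digraph T)" for e
    using that by (cases e; auto dest: in_arcsD1 in_arcsD2)+
  show "fst e \<noteq> snd e" if "e \<in> parcs (converse_digraph T)" for e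
    using that no_loop by (cases e) auto
  show "((u, v) \<in> parcs (converse_digraph T)) \<noteq> ((v, u) \<in> parcs (converse_digraph T))"
    if "u \<in> pverts (converse_digraph T)" "v \<in> pverts (converse_digraph T)" "u \<noteq> v" for u v
    using that exactly_one_arc[of u v] by auto
qed (simp_all add: pair_finite_verts pair_finite_arcs)

theorem theorem4p6:
  fixes T :: "'a pair_pre_digraph" and \<sigma> :: "'a list" and n i :: nat
  assumes "tournament T"
    and "Delta122_free T"
    and "card (pverts T) = n"
    and "vertex_ordering T \<sigma>"
    and "i < n"
    and "\<forall>v \<in> pverts T. v \<noteq> \<sigma> ! i \<longrightarrow> paved T \<sigma> v"
    and "nearly_paved T \<sigma> (\<sigma> ! i)"
  shows "paving_tournament T"
proof -
  interpret T: tournament T by fact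
  have free: "pattern_free T"
    using assms(2) by (rule T.Delta122_free_imp_pattern_free)
  have "\<exists>\<tau>. vertex_ordering T \<tau> \<and> (\<forall>w \<in> pverts T. paved T \<tau> w)"
    using assms(7) unfolding nearly_paved_def
  proof (elim disjE conjE)
    assume "card (left_neighbours T \<sigma> (\<sigma> ! i)) = 2" "card (right_neighbours T \<sigma> (\<sigma> ! i)) \<le> 1"
    then show ?thesis
      using T.nearly_paved_left_all_paved[OF free assms(4,6)] by blast
  next
    interpret C: tournament "converse_digraph T" by (rule T.tournament_converse)
    assume "card (left_neighbours T \<sigma> (\<sigma> ! i)) \<le> 1" "card (right_neighbours T \<sigma> (\<sigma> ! i)) = 2"
    then obtain \<tau> where "vertex_ordering (converse_digraph T) \<tau>"
      "\<forall>w \<in> pverts T. paved (converse_digraph T) \<tau> w"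
      using C.nearly_paved_left_all_paved[OF pattern_free_converse[OF free], of "rev \<sigma>" "\<sigma> ! i"]
        assms(4,6) by auto
    \<comment> \<open>Reversing the ordering found for the converse carries it back to
      \<open>T\<close>.\<close>
    then have "vertex_ordering T (rev \<tau>)" "\<forall>w \<in> pverts T. paved T (rev \<tau>) w"
      using vertex_ordering_converse[of T "rev \<tau>"] paved_converse[of T "rev \<tau>"] by auto
    then show ?thesis by blast
  qed
  then show ?thesis
    using T.paving_tournament_if_all_paved by blast
qed

end
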